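(* Let $H$ be an $r$-uniform hypergraph on $n$ vertices, $G$ a graph on $n$ vertices, and $k\ge1$ an integer. Then: (1) $f(H,1,k)=n-M(H,k-1)\ge n-\alpha(H)\,r\,(rk-r+1)$; (2) $n-\beta_{rk-1}(H)\ge f(H,1,k)\ge n-r\,\beta_{r(k-1)}(H)$; (3) if $G$ has average degree $\overline{d}\ge 4k-2$, then $f(G,k)\le \frac{\overline{d}-2k+1}{\overline{d}+1}\,n$.
   Context: An orientation $D$ of an $r$-uniform hypergraph $H$ assigns to each edge a linear ordering of its $r$ vertices (positions $1,\dots,r$); $\deg_i(v)$ is the number of edges in which $v$ occupies position $i$. $f(H,1,k)$ is the minimum over orientations $D$ of the number of vertices $v$ with $\deg_i(v)\ge k$ for all $i$; for a graph, $f(G,k)=f(G,1,k)$ (minimum number of vertices with indegree and outdegree at least $k$). For $F\subseteq V(H)$, $e(F)$ is the number of edges inside $F$; for $A\subseteq V(H)$, ${\rm Mad}(A)=\max\{r e(F)/|F|:\emptyset\neq F\subseteq A\}$. $M(H,j)=\max|A_1\cup\dots\cup A_r|$ over pairwise disjoint (possibly empty) $A_1,\dots,A_r\subseteq V(H)$ with ${\rm Mad}(A_i)\le rj$. A set $S\subseteq V(H)$ is independent if $|S\cap E|\le r-1$ for every edge $E$; $\alpha(H)$ is the maximum size of an independent set. A hypergraph is $d$-degenerate if every induced subhypergraph (including itself) has a vertex of degree at most $d$ in it; $\beta_d(H)$ is the maximum $|F|$ over $F\subseteq V(H)$ such that $H[F]$ is $d$-degenerate.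
   Formalization: The uniformity is assumed to satisfy r ≥ 2; for r = 1 the inequality in (1) is false (all singletons as edges, k = 2: α(H) = 0 and n − M(H,1) = 0, but the right-hand side is n). *)

theory Defs
  imports Complex_Main "HOL-Library.Disjoint_Sets"
begin

text \<open>A hypergraph is given by its vertex set \<open>V\<close> and its set of edges \<open>E\<close>. A (simple) graph is
  a \<open>2\<close>-uniform hypergraph.\<close>

definition uniform_hypergraph :: "nat \<Rightarrow> 'a set \<Rightarrow> 'a set set \<Rightarrow> bool" where
  "uniform_hypergraph r V E \<longleftrightarrow> finite V \<and> (\<forall>e\<in>E. e \<subseteq> V \<and> card e = r)"

abbreviation simple_graph :: "'a set \<Rightarrow> 'a set set \<Rightarrow> bool" where
  "simple_graph \<equiv> uniform_hypergraph 2"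

definition induced_edges :: "'a set set \<Rightarrow> 'a set \<Rightarrow> 'a set set" where
  "induced_edges E F = {e \<in> E. e \<subseteq> F}"

definition degree :: "'a set set \<Rightarrow> 'a \<Rightarrow> nat" where
  "degree E v = card {e \<in> E. v \<in> e}"

definition average_degree :: "'a set \<Rightarrow> 'a set set \<Rightarrow> real" where
  "average_degree V E = (\<Sum>v\<in>V. real (degree E v)) / real (card V)"

text \<open>The linear ordering of an edge \<open>e\<close> is encoded as the bijection \<open>D e\<close> sending each position
  in \<open>{1..r}\<close> to the vertex of \<open>e\<close> that occupies it.\<close>

definition orientation :: "nat \<Rightarrow> 'a set set \<Rightarrow> ('a set \<Rightarrow> nat \<Rightarrow> 'a) \<Rightarrow> bool" where
  "orientation r E D \<longleftrightarrow> (\<forall>e\<in>E. bij_betw (D e) {1..r} e)"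

definition pos_degree :: "'a set set \<Rightarrow> ('a set \<Rightarrow> nat \<Rightarrow> 'a) \<Rightarrow> nat \<Rightarrow> 'a \<Rightarrow> nat" where
  "pos_degree E D i v = card {e \<in> E. D e i = v}"

text \<open>\<open>f_one r V E k\<close> is $f(H,1,k)$ for the \<open>r\<close>-uniform hypergraph $H$ = \<open>(V, E)\<close>.\<close>

definition f_one :: "nat \<Rightarrow> 'a set \<Rightarrow> 'a set set \<Rightarrow> nat \<Rightarrow> nat" where
  "f_one r V E k =
     Min {card {v \<in> V. \<forall>i\<in>{1..r}. pos_degree E D i v \<ge> k} | D. orientation r E D}"

text \<open>For a graph, position 1 is the tail and position 2 the head of an oriented edge, so the two
  position degrees are the outdegree and the indegree.\<close>

definition f_graph :: "'a set \<Rightarrow> 'a set set \<Rightarrow> nat \<Rightarrow> nat" where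
  "f_graph V E k = f_one 2 V E k"

text \<open>The maximum over nonempty \<open>F\<close> is void for the empty set, whose value is taken to be \<open>0\<close>.\<close>

definition Mad :: "nat \<Rightarrow> 'a set set \<Rightarrow> 'a set \<Rightarrow> real" where
  "Mad r E A =
     (if A = {} then 0
      else Max {real r * real (card (induced_edges E F)) / real (card F) | F. F \<noteq> {} \<and> F \<subseteq> A})"

definition M_num :: "nat \<Rightarrow> 'a set \<Rightarrow> 'a set set \<Rightarrow> nat \<Rightarrow> nat" where
  "M_num r V E j =
     Max {card (\<Union>i\<in>{1..r}. A i) | A.
            disjoint_family_on A {1..r} \<and>
            (\<forall>i\<in>{1..r}. A i \<subseteq> V \<and> Mad r E (A i) \<le> real r * real j)}"

definition independent_set :: "nat \<Rightarrow> 'a set \<Rightarrow> 'a set set \<Rightarrow> 'a set \<Rightarrow> bool" where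
  "independent_set r V E S \<longleftrightarrow> S \<subseteq> V \<and> (\<forall>e\<in>E. card (S \<inter> e) \<le> r - 1)"

definition independence_number :: "nat \<Rightarrow> 'a set \<Rightarrow> 'a set set \<Rightarrow> nat" where
  "independence_number r V E = Max {card S | S. independent_set r V E S}"

text \<open>Induced subhypergraphs are taken on nonempty vertex sets; in particular, the hypergraph
  without vertices is degenerate.\<close>

definition degenerate :: "nat \<Rightarrow> 'a set \<Rightarrow> 'a set set \<Rightarrow> bool" where
  "degenerate d V E \<longleftrightarrow>
     (\<forall>F. F \<noteq> {} \<and> F \<subseteq> V \<longrightarrow> (\<exists>v\<in>F. degree (induced_edges E F) v \<le> d))"

definition beta_num :: "nat \<Rightarrow> 'a set \<Rightarrow> 'a set set \<Rightarrow> nat" where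
  "beta_num d V E = Max {card F | F. F \<subseteq> V \<and> degenerate d F (induced_edges E F)}"

end

theory Submission
  imports Defs
begin

text \<open>A vertex that is bad for an orientation has some position degree at most \<open>k - 1\<close>; sorting the
  bad vertices by such a position gives the sets counted by \<open>M(H, k - 1)\<close>. Conversely, Hall's theorem
  lets every edge inside \<open>A\<^sub>i\<close> choose the vertex in its position \<open>i\<close> so that no vertex is chosen more
  than \<open>k - 1\<close> times, and lets every other position \<open>i\<close> be filled from outside \<open>A\<^sub>i\<close>.
  Sets of small maximum average degree are degenerate, and conversely colouring a degenerate
  hypergraph greedily splits it into sets of small maximum average degree.
  Part (3) needs a \<open>(2k - 1)\<close>-degenerate set of size at least
  \<open>\<Sum>v. min 1 (2k / (deg v + 1))\<close> (Alon, Kahn, Seymour). It is found by deleting vertices: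
  a vertex of degree less than \<open>2k\<close> may be kept, and if there is none, discarding a vertex
  of maximum degree does not decrease the sum. A chord of the convex function \<open>2k / (x + 1)\<close>
  between consecutive integers then bounds the sum in terms of the average degree.\<close>

section \<open>Hall's theorem\<close>

text \<open>Rado's argument: while some \<open>S i\<close> has two elements, one of them can be removed without
  violating Hall's condition.\<close>

theorem hall:
  fixes S :: "'i \<Rightarrow> 'b set"
  assumes "finite I" and "\<And>i. i \<in> I \<Longrightarrow> finite (S i)"
    and "\<And>J. J \<subseteq> I \<Longrightarrow> card J \<le> card (\<Union>(S ` J))"
  shows "\<exists>f. inj_on f I \<and> (\<forall>i\<in>I. f i \<in> S i)"
  using assms(2,3)
proof (induction "\<Sum>i\<in>I. card (S i)" arbitrary: S rule: less_induct)
  case less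
  note fin = less.prems(1) and hc = less.prems(2)
  show ?case
  proof (cases "\<forall>i\<in>I. card (S i) \<le> 1")
    case True
    have "\<exists>x. S i = {x}" if "i \<in> I" for i
    proof -
      have "card {i} \<le> card (\<Union>(S ` {i}))" using that by (intro hc) auto
      then have "card (S i) = 1" using True that by force
      then show ?thesis by (auto simp: card_1_singleton_iff)
    qed
    then obtain f where f: "\<And>i. i \<in> I \<Longrightarrow> S i = {f i}" by metis
    \<comment> \<open>Once all sets are singletons, Hall's condition on pairs of indices is
      injectivity of the choice.\<close>
    have "i = j" if "i \<in> I" "j \<in> I" "f i = f j" for i j
    proof (rule ccontr)
      assume "i \<noteq> j"
      have "card {i, j} \<le> card (\<Union>(S ` {i, j}))" using that by (intro hc) auto
      moreover have "\<Union>(S ` {i, j}) = {f i}" using f that by auto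
      ultimately show False using \<open>i \<noteq> j\<close> by simp
    qed
    then have "inj_on f I" by (auto intro: inj_onI)
    then show ?thesis using f by blast
  next
    case False
    then obtain i where i: "i \<in> I" "\<not> card (S i) \<le> 1" by blast
    then have "\<exists>x\<in>S i. \<exists>y\<in>S i. x \<noteq> y"
      using card_le_Suc0_iff_eq[OF fin[OF i(1)]] by auto
    then obtain x y where xy: "x \<in> S i" "y \<in> S i" "x \<noteq> y" by blast
    define U where "U J = \<Union>(S ` J)" for J
    have finU: "finite (U J)" if "J \<subseteq> I" for J
      unfolding U_def using that fin finite_subset[OF _ assms(1)] by blast
    have step: ?thesis
      if z: "z \<in> S i" and h: "\<And>J. J \<subseteq> I \<Longrightarrow> card J \<le> card (\<Union>((S(i := S i - {z})) ` J))" for z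
    proof -
      let ?T = "S(i := S i - {z})"
      have "card (S i - {z}) < card (S i)" by (rule card_Diff1_less[OF fin[OF i(1)] z])
      then have "(\<Sum>i\<in>I. card (?T i)) < (\<Sum>i\<in>I. card (S i))"
        using i(1) assms(1) by (intro sum_strict_mono_ex1) (auto intro!: bexI[of _ i])
      then have "\<exists>f. inj_on f I \<and> (\<forall>i\<in>I. f i \<in> ?T i)"
        using fin by (intro less.hyps h) auto
      then show ?thesis by (metis (mono_tags, lifting) Diff_iff fun_upd_other fun_upd_same)
    qed
    \<comment> \<open>Shrinking \<open>S i\<close> can only spoil index sets that contain
      \<open>i\<close>; \<open>K\<close> is such a set with \<open>i\<close> taken out, which turns
      a strict inequality into a weak one.\<close>
    have violation: "\<exists>K. K \<subseteq> I - {i} \<and> card ((S i - {z}) \<union> U K) \<le> card K"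
      if J: "J \<subseteq> I" "\<not> card J \<le> card (\<Union>((S(i := S i - {z})) ` J))" for z J
    proof -
      have "i \<in> J"
      proof (rule ccontr)
        assume "i \<notin> J"
        then have "\<Union>((S(i := S i - {z})) ` J) = \<Union>(S ` J)" by auto
        then show False using hc[OF J(1)] J(2) by simp
      qed
      then have "\<Union>((S(i := S i - {z})) ` J) = (S i - {z}) \<union> U (J - {i})"
        unfolding U_def by (auto split: if_splits)
      moreover have "card J = Suc (card (J - {i}))"
        using \<open>i \<in> J\<close> finite_subset[OF J(1) assms(1)] by (metis card_Suc_Diff1)
      ultimately show ?thesis using J by (intro exI[of _ "J - {i}"]) auto
    qed
    show ?thesis
    proof (rule ccontr)
      assume "\<not> ?thesis"
      then obtain K L where K: "K \<subseteq> I - {i}" "card ((S i - {x}) \<union> U K) \<le> card K"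
        and L: "L \<subseteq> I - {i}" "card ((S i - {y}) \<union> U L) \<le> card L"
        using step[OF xy(1)] step[OF xy(2)] violation by metis
      \<comment> \<open>Submodularity: since \<open>x \<noteq> y\<close>,
        \<open>?P \<union> ?Q\<close> is the whole union over
        \<open>insert i (K \<union> L)\<close>, while \<open>?P \<inter> ?Q\<close> contains
        \<open>U (K \<inter> L)\<close>. Hall's condition for these two index sets adds up to
        \<open>card K + card L + 1 \<le> card ?P + card ?Q\<close>, against the choice of
        \<open>K\<close> and \<open>L\<close>.\<close>
      let ?P = "(S i - {x}) \<union> U K" and ?Q = "(S i - {y}) \<union> U L"
      have finKL: "finite K" "finite L" using K L finite_subset[OF _ assms(1)] by blast+
      have finPQ: "finite ?P" "finite ?Q" using K(1) L(1) fin[OF i(1)] finU by blast+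
      have "card (insert i (K \<union> L)) \<le> card (\<Union>(S ` insert i (K \<union> L)))"
        using K(1) L(1) i(1) by (intro hc) blast
      also have "\<Union>(S ` insert i (K \<union> L)) = ?P \<union> ?Q"
        using xy unfolding U_def by blast
      finally have "card (insert i (K \<union> L)) \<le> card (?P \<union> ?Q)" .
      then have 1: "Suc (card (K \<union> L)) \<le> card (?P \<union> ?Q)"
        using K(1) L(1) finKL by (subst (asm) card_insert_disjoint) auto
      have "card (K \<inter> L) \<le> card (U (K \<inter> L))" unfolding U_def using K by (intro hc) auto
      also have "\<dots> \<le> card (?P \<inter> ?Q)" using finPQ by (intro card_mono) (auto simp: U_def)
      finally have 2: "card (K \<inter> L) \<le> card (?P \<inter> ?Q)" .
      show False
        using 1 2 K(2) L(2) card_Un_Int[OF finPQ] card_Un_Int[OF finKL] by linarith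
    qed
  qed
qed

section \<open>Sparse sets\<close>

text \<open>The condition that \<open>Mad\<close> is at most \<open>r * j\<close>, with the
  denominator and the common factor \<open>r\<close> cleared.\<close>

definition sparse :: "nat \<Rightarrow> 'a set set \<Rightarrow> 'a set \<Rightarrow> bool" where
  "sparse j E A \<longleftrightarrow> (\<forall>F\<subseteq>A. card (induced_edges E F) \<le> j * card F)"

lemma uniform_hypergraph_finite_edges:
  assumes "uniform_hypergraph r V E"
  shows "finite E"
  using assms finite_subset[of E "Pow V"] unfolding uniform_hypergraph_def by auto

lemma induced_edges_empty:
  assumes "uniform_hypergraph r V E" and "r > 0"
  shows "induced_edges E {} = {}"
  using assms unfolding uniform_hypergraph_def induced_edges_def by auto

lemma induced_edges_induced_edges:
  assumes "F \<subseteq> A"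
  shows "induced_edges (induced_edges E A) F = induced_edges E F"
  using assms unfolding induced_edges_def by auto

text \<open>A finite maximum is bounded iff every member is. The empty \<open>F\<close>, absent from
  \<open>Mad\<close>, adds no constraint because edges are nonempty.\<close>

lemma Mad_le_iff_sparse:
  assumes H: "uniform_hypergraph r V E" and r: "r > 0" and A: "A \<subseteq> V"
  shows "Mad r E A \<le> real r * real j \<longleftrightarrow> sparse j E A"
proof (cases "A = {}")
  case True
  then show ?thesis
    using induced_edges_empty[OF H r] by (simp add: Mad_def sparse_def)
next
  case False
  have fin: "finite A" using A H finite_subset unfolding uniform_hypergraph_def by blast
  let ?g = "\<lambda>F. real r * real (card (induced_edges E F)) / real (card F)"
  have eq: "{?g F | F. F \<noteq> {} \<and> F \<subseteq> A} = ?g ` (Pow A - {{}})" by auto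
  have "Mad r E A \<le> real r * real j \<longleftrightarrow> (\<forall>F\<in>Pow A - {{}}. ?g F \<le> real r * real j)"
  proof -
    have "finite (?g ` (Pow A - {{}}))" "?g ` (Pow A - {{}}) \<noteq> {}" using fin False by auto
    then show ?thesis using False unfolding Mad_def eq if_not_P[OF False]
      by (subst Max_le_iff) (blast, blast, simp only: ball_simps)
  qed
  also have "\<dots> \<longleftrightarrow> (\<forall>F\<in>Pow A - {{}}. card (induced_edges E F) \<le> j * card F)"
  proof (intro ball_cong refl)
    fix F assume "F \<in> Pow A - {{}}"
    then have "card F > 0" using fin finite_subset by (auto simp: card_gt_0_iff)
    then have "?g F \<le> real r * real j \<longleftrightarrow>
        real (card (induced_edges E F)) \<le> real (j * card F)"
      using r by (simp add: divide_le_eq mult.assoc)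
    then show "?g F \<le> real r * real j \<longleftrightarrow> card (induced_edges E F) \<le> j * card F"
      by (simp only: of_nat_le_iff)
  qed
  also have "\<dots> \<longleftrightarrow> sparse j E A"
  proof -
    have "card (induced_edges E {}) \<le> j * card {}" using induced_edges_empty[OF H r] by simp
    then show ?thesis unfolding sparse_def by blast
  qed
  finally show ?thesis .
qed

text \<open>Double counting of the incidences between vertices and edges.\<close>

lemma sum_degree:
  assumes "finite E" and "finite F" and "\<And>e. e \<in> E \<Longrightarrow> e \<subseteq> F \<and> card e = r"
  shows "(\<Sum>v\<in>F. degree E v) = r * card E"
proof -
  have "(\<Sum>v\<in>F. degree E v) = (\<Sum>e\<in>E. card {v \<in> F. v \<in> e})"
    unfolding degree_def using assms(1,2) by (intro sum_multicount_gen) auto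
  also have "\<dots> = (\<Sum>e\<in>E. r)"
  proof (intro sum.cong refl)
    fix e assume "e \<in> E"
    then have "{v \<in> F. v \<in> e} = e" "card e = r" using assms(3) by auto
    then show "card {v \<in> F. v \<in> e} = r" by simp
  qed
  finally show ?thesis by simp
qed

lemma sum_degree_induced:
  assumes H: "uniform_hypergraph r V E" and "F \<subseteq> V"
  shows "(\<Sum>v\<in>F. degree (induced_edges E F) v) = r * card (induced_edges E F)"
proof (rule sum_degree)
  show "finite (induced_edges E F)"
    using uniform_hypergraph_finite_edges[OF H] by (simp add: induced_edges_def)
  show "finite F" using assms finite_subset unfolding uniform_hypergraph_def by blast
qed (use H in \<open>auto simp: uniform_hypergraph_def induced_edges_def\<close>)

text \<open>Sparseness bounds the average degree inside every nonempty \<open>F\<close> by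
  \<open>r * j\<close>, so some vertex does not exceed it.\<close>

lemma sparse_imp_degenerate:
  assumes H: "uniform_hypergraph r V E" and A: "A \<subseteq> V" and sp: "sparse j E A"
  shows "degenerate (r * j) A E"
  unfolding degenerate_def
proof (intro allI impI, rule ccontr)
  fix F assume F: "F \<noteq> {} \<and> F \<subseteq> A"
    and neg: "\<not> (\<exists>v\<in>F. degree (induced_edges E F) v \<le> r * j)"
  have "finite F" using F A H finite_subset unfolding uniform_hypergraph_def by (metis subset_trans)
  then have "(\<Sum>v\<in>F. r * j) < (\<Sum>v\<in>F. degree (induced_edges E F) v)"
    using F neg by (intro sum_strict_mono) auto
  also have "\<dots> = r * card (induced_edges E F)"
    using F A by (intro sum_degree_induced[OF H]) auto
  also have "\<dots> \<le> r * (j * card F)" using sp F unfolding sparse_def by (intro mult_left_mono) auto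
  finally show False by (simp add: mult.assoc mult.left_commute)
qed

lemma degenerate_induced_edges:
  "degenerate d A (induced_edges E A) \<longleftrightarrow> degenerate d A E"
  unfolding degenerate_def by (metis induced_edges_induced_edges)

lemma degenerate_subset:
  assumes "degenerate d A E" and "B \<subseteq> A"
  shows "degenerate d B E"
  using assms unfolding degenerate_def by (meson subset_trans)

text \<open>Taking \<open>v\<close> out of a set \<open>F\<close> loses at most \<open>j\<close>
  edges, and the allowance \<open>j * card F\<close> drops by exactly \<open>j\<close>.\<close>

lemma sparse_insert:
  assumes "finite A" and "finite E" and "v \<notin> A" and sp: "sparse j E A"
    and deg: "degree (induced_edges E (insert v A)) v \<le> j"
  shows "sparse j E (insert v A)"
  unfolding sparse_def
proof (intro allI impI)
  fix F assume F: "F \<subseteq> insert v A"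
  have finF: "finite F" using F assms(1) finite_subset by blast
  have le: "card (induced_edges E (F - {v})) \<le> j * card (F - {v})"
  proof -
    have "F - {v} \<subseteq> A" using F by blast
    then show ?thesis using sp unfolding sparse_def by blast
  qed
  show "card (induced_edges E F) \<le> j * card F"
  proof (cases "v \<in> F")
    case True
    let ?X = "{e \<in> induced_edges E (insert v A). v \<in> e}"
    have "induced_edges E F \<subseteq> induced_edges E (F - {v}) \<union> ?X"
      using F unfolding induced_edges_def by auto
    then have "card (induced_edges E F) \<le> card (induced_edges E (F - {v}) \<union> ?X)"
      using assms(2) by (intro card_mono) (auto simp: induced_edges_def)
    also have "\<dots> \<le> card (induced_edges E (F - {v})) + card ?X" by (rule card_Un_le)
    also have "\<dots> \<le> j * card (F - {v}) + j" using le deg unfolding degree_def by linarith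
    also have "\<dots> = j * card F"
      using True finF card_Suc_Diff1[of F v] by (metis mult_Suc_right add.commute)
    finally show ?thesis .
  qed (use le in simp)
qed

text \<open>Since \<open>r \<ge> 2\<close>, the edges through a new vertex \<open>v\<close> that would become monochromatic are
  distinct for distinct colours of \<open>v\<close>, so some colour is responsible for less than \<open>k\<close> of them.\<close>

lemma degenerate_sparse_colouring:
  assumes H: "uniform_hypergraph r V E" and r: "r \<ge> 2" and A: "A \<subseteq> V"
    and deg: "degenerate d A E" and d: "d < m * k"
  shows "\<exists>c. (\<forall>v\<in>A. c v < m) \<and> (\<forall>i<m. sparse (k - 1) E {v \<in> A. c v = i})"
proof -
  have finE: "finite E" using uniform_hypergraph_finite_edges[OF H] .
  have "finite A" using A H finite_subset unfolding uniform_hypergraph_def by blast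
  then show ?thesis using A deg
  proof (induction A rule: finite_psubset_induct)
    case (psubset A)
    show ?case
    proof (cases "A = {}")
      case True
      then show ?thesis using induced_edges_empty[OF H] r by (simp add: sparse_def)
    next
      case False
      then obtain v where v: "v \<in> A" "degree (induced_edges E A) v \<le> d"
        using psubset.prems unfolding degenerate_def by blast
      have "degenerate d (A - {v}) E" using degenerate_subset[OF psubset.prems(2)] by blast
      moreover have "A - {v} \<subset> A" "A - {v} \<subseteq> V" using v psubset.prems by auto
      ultimately obtain c where c: "\<And>u. u \<in> A - {v} \<Longrightarrow> c u < m"
          "\<And>i. i < m \<Longrightarrow> sparse (k - 1) E {u \<in> A - {v}. c u = i}"
        using psubset.IH[of "A - {v}"] by blast
      \<comment> \<open>\<open>C i\<close> is a colour class of the colouring without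
        \<open>v\<close>; \<open>X i\<close> collects the edges that become monochromatic if
        \<open>v\<close> receives colour \<open>i\<close>.\<close>
      define C where "C i = {u \<in> A - {v}. c u = i}" for i
      define X where "X i = {e \<in> induced_edges E (insert v (C i)). v \<in> e}" for i
      have finX: "finite (X i)" for i using finE unfolding X_def induced_edges_def by auto
      have disj: "X i \<inter> X j = {}" if "i \<noteq> j" for i j
      proof (rule ccontr)
        assume "X i \<inter> X j \<noteq> {}"
        then obtain e where e: "e \<in> X i" "e \<in> X j" by blast
        then have "e \<subseteq> {v}" using that unfolding X_def induced_edges_def C_def by auto
        then have "card e \<le> 1" using card_mono[of "{v}" e] by simp
        then show False
          using e H r unfolding X_def induced_edges_def uniform_hypergraph_def by auto
      qed
      \<comment> \<open>Pigeonhole: otherwise the disjoint sets \<open>X i\<close> would give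
        \<open>v\<close> degree at least \<open>m * k\<close>, which exceeds
        \<open>d\<close>.\<close>
      have "\<exists>i<m. card (X i) < k"
      proof (rule ccontr)
        assume "\<not> ?thesis"
        then have "(\<Sum>i<m. k) \<le> (\<Sum>i<m. card (X i))" by (intro sum_mono) auto
        also have "\<dots> = card (\<Union>i<m. X i)"
          using finX disj by (intro card_UN_disjoint[symmetric]) auto
        also have "\<dots> \<le> degree (induced_edges E A) v"
          unfolding degree_def using finE v
          by (intro card_mono) (auto simp: X_def induced_edges_def C_def)
        finally show False using v d by simp
      qed
      then obtain i where i: "i < m" "card (X i) < k" by blast
      let ?c = "c(v := i)"
      have "sparse (k - 1) E {u \<in> A. ?c u = l}" if "l < m" for l
      proof (cases "l = i")
        case True
        have "{u \<in> A. ?c u = l} = insert v (C i)" using True v unfolding C_def by auto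
        moreover have "sparse (k - 1) E (insert v (C i))"
          using i c(2)[OF i(1)] psubset.hyps finE
          by (intro sparse_insert) (auto simp: C_def[symmetric] degree_def X_def[symmetric], auto simp: C_def)
        ultimately show ?thesis by simp
      next
        case False
        then have "{u \<in> A. ?c u = l} = C l" unfolding C_def by auto
        then show ?thesis using c(2)[OF that] unfolding C_def by simp
      qed
      moreover have "\<forall>u\<in>A. ?c u < m" using c(1) i by auto
      ultimately show ?thesis by blast
    qed
  qed
qed

section \<open>Orientations\<close>

text \<open>Hall's theorem with every vertex available in \<open>j\<close> copies: injectivity on
  the pairs means that no vertex is chosen more than \<open>j\<close> times. Hall's condition for
  \<open>J\<close> is sparseness of the vertex set \<open>\<Union>J\<close>.\<close>

lemma sparse_selection:
  assumes "finite A" and "finite E" and sp: "sparse j E A"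
  shows "\<exists>c. (\<forall>e\<in>induced_edges E A. c e \<in> e) \<and>
    (\<forall>v. card {e \<in> induced_edges E A. c e = v} \<le> j)"
proof -
  let ?I = "induced_edges E A"
  have fin: "finite ?I" using assms(2) by (simp add: induced_edges_def)
  have "\<exists>f. inj_on f ?I \<and> (\<forall>e\<in>?I. f e \<in> e \<times> {..<j})"
  proof (rule hall[OF fin])
    fix e assume "e \<in> ?I"
    then show "finite (e \<times> {..<j})" using assms(1) finite_subset
      by (auto simp: induced_edges_def)
  next
    fix J assume J: "J \<subseteq> ?I"
    then have sub: "\<Union>J \<subseteq> A" by (auto simp: induced_edges_def)
    have "J \<subseteq> induced_edges E (\<Union>J)" using J by (auto simp: induced_edges_def)
    then have "card J \<le> card (induced_edges E (\<Union>J))"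
      using assms(2) by (intro card_mono) (auto simp: induced_edges_def)
    also have "\<dots> \<le> j * card (\<Union>J)" using sp sub by (auto simp: sparse_def)
    also have "\<dots> = card (\<Union>J \<times> {..<j})" by (simp add: card_cartesian_product mult.commute)
    also have "\<Union>J \<times> {..<j} = (\<Union>e\<in>J. e \<times> {..<j})" by auto
    finally show "card J \<le> card (\<Union>e\<in>J. e \<times> {..<j})" .
  qed
  then obtain f where f: "inj_on f ?I" "\<And>e. e \<in> ?I \<Longrightarrow> f e \<in> e \<times> {..<j}" by blast
  have "card {e \<in> ?I. fst (f e) = v} \<le> j" for v
  proof -
    have "inj_on (snd \<circ> f) {e \<in> ?I. fst (f e) = v}"
      using f(1) by (auto simp: inj_on_def prod_eq_iff)
    moreover have "(snd \<circ> f) ` {e \<in> ?I. fst (f e) = v} \<subseteq> {..<j}" using f(2) by fastforce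
    ultimately show ?thesis using card_inj_on_le[of _ _ "{..<j}"] by fastforce
  qed
  then show ?thesis using f(2) by (intro exI[of _ "\<lambda>e. fst (f e)"]) (auto simp: mem_Times_iff)
qed

text \<open>Hall's theorem for the positions. One position alone has an admissible vertex, and any
  two already admit all of \<open>e\<close> between them, since their forbidden sets are
  disjoint.\<close>

lemma avoiding_bij:
  fixes X :: "nat \<Rightarrow> 'a set"
  assumes e: "finite e" "card e = r" and disj: "disjoint_family_on X {1..r}"
    and X: "\<And>i. i \<in> {1..r} \<Longrightarrow> \<not> e \<subseteq> X i"
  shows "\<exists>p. bij_betw p {1..r} e \<and> (\<forall>i\<in>{1..r}. p i \<notin> X i)"
proof -
  have "\<exists>p. inj_on p {1..r} \<and> (\<forall>i\<in>{1..r}. p i \<in> e - X i)"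
  proof (rule hall)
    fix J assume J: "J \<subseteq> {1..r}"
    have finJ: "finite J" using J finite_subset by blast
    have finU: "finite (\<Union>i\<in>J. e - X i)" using finJ e(1) by auto
    show "card J \<le> card (\<Union>i\<in>J. e - X i)"
    proof (cases "card J \<le> 1")
      case True
      have "card (\<Union>i\<in>J. e - X i) > 0" if "i \<in> J" for i
      proof -
        have "i \<in> {1..r}" using that J by blast
        then have "(\<Union>i\<in>J. e - X i) \<noteq> {}" using that X by blast
        then show ?thesis using finU by (simp only: card_gt_0_iff) blast
      qed
      then show ?thesis using True by (cases "J = {}") (force, fastforce)
    next
      case False
      then obtain a b where ab: "a \<in> J" "b \<in> J" "a \<noteq> b"
        using card_le_Suc0_iff_eq[OF finJ] by auto
      then have "X a \<inter> X b = {}" using disj J unfolding disjoint_family_on_def by blast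
      then have "e \<subseteq> (\<Union>i\<in>J. e - X i)" using ab by blast
      then have "card e \<le> card (\<Union>i\<in>J. e - X i)" using finU card_mono by blast
      moreover have "card J \<le> r" using J card_mono[of "{1..r}" J] by simp
      ultimately show ?thesis using e by simp
    qed
  qed (use e in auto)
  then obtain p where p: "inj_on p {1..r}" "\<And>i. i \<in> {1..r} \<Longrightarrow> p i \<in> e - X i" by blast
  have "p ` {1..r} = e"
    using p e by (intro card_subset_eq) (auto simp: card_image)
  then show ?thesis using p by (auto simp: bij_betw_def)
qed

lemma exists_orientation:
  assumes H: "uniform_hypergraph r V E"
    and A: "\<And>i. i \<in> {1..r} \<Longrightarrow> A i \<subseteq> V" and disj: "disjoint_family_on A {1..r}"
    and sp: "\<And>i. i \<in> {1..r} \<Longrightarrow> sparse j E (A i)"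
  shows "\<exists>D. orientation r E D \<and> (\<forall>i\<in>{1..r}. \<forall>v\<in>A i. pos_degree E D i v \<le> j)"
proof -
  have finE: "finite E" using uniform_hypergraph_finite_edges[OF H] .
  have "\<exists>c. (\<forall>e\<in>induced_edges E (A i). c e \<in> e) \<and>
      (\<forall>v. card {e \<in> induced_edges E (A i). c e = v} \<le> j)" if "i \<in> {1..r}" for i
    using sparse_selection[OF _ finE sp[OF that]] A[OF that] H finite_subset
    unfolding uniform_hypergraph_def by blast
  then have "\<exists>c. \<forall>i\<in>{1..r}. (\<forall>e\<in>induced_edges E (A i). c i e \<in> e) \<and>
      (\<forall>v. card {e \<in> induced_edges E (A i). c i e = v} \<le> j)"
    by (intro bchoice) blast
  then obtain c where c: "\<And>i e. i \<in> {1..r} \<Longrightarrow> e \<in> induced_edges E (A i) \<Longrightarrow> c i e \<in> e"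
      "\<And>i v. i \<in> {1..r} \<Longrightarrow> card {e \<in> induced_edges E (A i). c i e = v} \<le> j"
    by blast
  \<comment> \<open>Vertices forbidden at position \<open>i\<close>: an edge inside
    \<open>A i\<close> must put its selected vertex there, any other edge a vertex outside
    \<open>A i\<close>. Both alternatives lie in \<open>A i\<close>, so disjointness is inherited,
    and neither contains all of \<open>e\<close>.\<close>
  define X where "X e i = (if e \<subseteq> A i then e - {c i e} else e \<inter> A i)" for e i
  have "\<exists>p. bij_betw p {1..r} e \<and> (\<forall>i\<in>{1..r}. p i \<notin> X e i)" if e: "e \<in> E" for e
  proof (rule avoiding_bij)
    show "finite e" "card e = r" using e H finite_subset unfolding uniform_hypergraph_def by blast+
    have "X e i \<subseteq> A i" for i unfolding X_def by auto
    then show "disjoint_family_on (X e) {1..r}"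
      using disj unfolding disjoint_family_on_def by blast
    fix i assume "i \<in> {1..r}"
    then show "\<not> e \<subseteq> X e i"
      using c(1)[of i e] e unfolding X_def induced_edges_def by auto
  qed
  then obtain D where D: "\<And>e. e \<in> E \<Longrightarrow> bij_betw (D e) {1..r} e"
      "\<And>e i. e \<in> E \<Longrightarrow> i \<in> {1..r} \<Longrightarrow> D e i \<notin> X e i" by metis
  have "pos_degree E D i v \<le> j" if i: "i \<in> {1..r}" and v: "v \<in> A i" for i v
  proof -
    \<comment> \<open>A vertex of \<open>A i\<close> reaches position \<open>i\<close> only in edges
      inside \<open>A i\<close> that selected it.\<close>
    have "{e \<in> E. D e i = v} \<subseteq> {e \<in> induced_edges E (A i). c i e = v}"
    proof
      fix e assume "e \<in> {e \<in> E. D e i = v}"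
      then have e: "e \<in> E" "D e i = v" by auto
      then have "v \<in> e" using D(1)[OF e(1)] i by (auto simp: bij_betw_def)
      then show "e \<in> {e \<in> induced_edges E (A i). c i e = v}"
        using e D(2)[OF e(1) i] v unfolding X_def induced_edges_def by (auto split: if_splits)
    qed
    then have "pos_degree E D i v \<le> card {e \<in> induced_edges E (A i). c i e = v}"
      unfolding pos_degree_def using finE by (intro card_mono) (auto simp: induced_edges_def)
    then show ?thesis using c(2)[OF i, of v] by linarith
  qed
  then show ?thesis using D(1) unfolding orientation_def by blast
qed

section \<open>Extremal values: finiteness, bounds and attainment\<close>

lemma finite_cards:
  assumes "finite V" and "\<And>x. P x \<Longrightarrow> f x \<subseteq> V"
  shows "finite {card (f x) | x. P x}"
proof (rule finite_subset)
  show "{card (f x) | x. P x} \<subseteq> {..card V}" using assms by (auto intro: card_mono)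
qed simp

lemma f_one_le:
  assumes "finite V" and "orientation r E D"
  shows "f_one r V E k \<le> card {v \<in> V. \<forall>i\<in>{1..r}. pos_degree E D i v \<ge> k}"
  unfolding f_one_def
proof (rule Min_le)
  show "finite {card {v \<in> V. \<forall>i\<in>{1..r}. pos_degree E D i v \<ge> k} | D. orientation r E D}"
    using assms(1) by (rule finite_cards) auto
qed (use assms(2) in blast)

lemma f_one_attained:
  assumes H: "uniform_hypergraph r V E"
  obtains D where "orientation r E D"
    "f_one r V E k = card {v \<in> V. \<forall>i\<in>{1..r}. pos_degree E D i v \<ge> k}"
proof -
  let ?Z = "{card {v \<in> V. \<forall>i\<in>{1..r}. pos_degree E D i v \<ge> k} | D. orientation r E D}"
  have "finite V" using H by (simp add: uniform_hypergraph_def)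
  then have fin: "finite ?Z"
    by (rule finite_cards) auto
  have "\<exists>p. bij_betw p {1..r} e" if "e \<in> E" for e
  proof -
    have "finite e" "card e = r" using that H finite_subset unfolding uniform_hypergraph_def by blast+
    then show ?thesis by (intro finite_same_card_bij) auto
  qed
  then have "\<exists>D. orientation r E D" unfolding orientation_def by metis
  then have "?Z \<noteq> {}" by blast
  from Min_in[OF fin this] show ?thesis using that unfolding f_one_def by blast
qed

lemma M_num_eq:
  assumes H: "uniform_hypergraph r V E" and r: "r > 0"
  shows "M_num r V E j =
     Max {card (\<Union>i\<in>{1..r}. A i) | A.
            disjoint_family_on A {1..r} \<and> (\<forall>i\<in>{1..r}. A i \<subseteq> V \<and> sparse j E (A i))}"
  unfolding M_num_def using Mad_le_iff_sparse[OF H r] by (metis (mono_tags, lifting))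

lemma finite_M_num_set:
  assumes "finite V"
  shows "finite {card (\<Union>i\<in>{1..r}. A i) | A :: nat \<Rightarrow> 'a set.
            disjoint_family_on A {1..r} \<and> (\<forall>i\<in>{1..r}. A i \<subseteq> V \<and> sparse j E (A i))}"
  using assms by (rule finite_cards) auto

lemma M_num_ge:
  assumes H: "uniform_hypergraph r V E" and r: "r > 0"
    and "disjoint_family_on A {1..r}" and "\<And>i. i \<in> {1..r} \<Longrightarrow> A i \<subseteq> V \<and> sparse j E (A i)"
  shows "card (\<Union>i\<in>{1..r}. A i) \<le> M_num r V E j"
  unfolding M_num_eq[OF H r]
proof (rule Max_ge[OF finite_M_num_set])
  show "finite V" using H by (simp add: uniform_hypergraph_def)
qed (use assms(3,4) in blast)

lemma M_num_attained:
  assumes H: "uniform_hypergraph r V E" and r: "r > 0"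
  obtains A where "disjoint_family_on A {1..r}"
    "\<And>i. i \<in> {1..r} \<Longrightarrow> A i \<subseteq> V \<and> sparse j E (A i)"
    "M_num r V E j = card (\<Union>i\<in>{1..r}. A i)"
proof -
  let ?Z = "{card (\<Union>i\<in>{1..r}. A i) | A.
            disjoint_family_on A {1..r} \<and> (\<forall>i\<in>{1..r}. A i \<subseteq> V \<and> sparse j E (A i))}"
  have "finite V" using H by (simp add: uniform_hypergraph_def)
  then have fin: "finite ?Z" by (rule finite_M_num_set)
  have "sparse j E {}" using induced_edges_empty[OF H r] by (simp add: sparse_def)
  then have "?Z \<noteq> {}" by (auto simp: disjoint_family_on_def intro!: exI[of _ "\<lambda>_. {}"])
  from Max_in[OF fin this] show ?thesis using that unfolding M_num_eq[OF H r] by blast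
qed

text \<open>Stated as a sum to avoid truncated subtraction. The first inequality orients for an
  optimal family \<open>A\<close>, the second sorts the bad vertices of an optimal
  orientation.\<close>

lemma f_one_plus_M_num:
  assumes H: "uniform_hypergraph r V E" and r: "r > 0" and k: "k \<ge> 1"
  shows "f_one r V E k + M_num r V E (k - 1) = card V"
proof (rule antisym)
  have finV: "finite V" using H by (simp add: uniform_hypergraph_def)
  obtain A where A: "disjoint_family_on A {1..r}"
    "\<And>i. i \<in> {1..r} \<Longrightarrow> A i \<subseteq> V \<and> sparse (k - 1) E (A i)"
    "M_num r V E (k - 1) = card (\<Union>i\<in>{1..r}. A i)"
    using M_num_attained[OF H r] by metis
  obtain D where D: "orientation r E D" "\<forall>i\<in>{1..r}. \<forall>v\<in>A i. pos_degree E D i v \<le> k - 1"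
    using exists_orientation[OF H _ A(1)] A(2) by metis
  let ?G = "{v \<in> V. \<forall>i\<in>{1..r}. pos_degree E D i v \<ge> k}"
  have sub: "(\<Union>i\<in>{1..r}. A i) \<subseteq> V" using A(2) by blast
  have "?G \<inter> (\<Union>i\<in>{1..r}. A i) = {}" using D(2) k by fastforce
  then have "card ?G + card (\<Union>i\<in>{1..r}. A i) = card (?G \<union> (\<Union>i\<in>{1..r}. A i))"
    using finV finite_subset[OF sub finV] by (intro card_Un_disjoint[symmetric]) auto
  also have "\<dots> \<le> card V" using sub finV by (intro card_mono) auto
  finally show "f_one r V E k + M_num r V E (k - 1) \<le> card V"
    using f_one_le[OF finV D(1), of k] A(3) by linarith
next
  have finV: "finite V" using H by (simp add: uniform_hypergraph_def)
  have finE: "finite E" using uniform_hypergraph_finite_edges[OF H] .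
  obtain D where D: "orientation r E D"
    "f_one r V E k = card {v \<in> V. \<forall>i\<in>{1..r}. pos_degree E D i v \<ge> k}"
    by (rule f_one_attained[OF H])
  let ?G = "{v \<in> V. \<forall>i\<in>{1..r}. pos_degree E D i v \<ge> k}"
  have "\<exists>i. i \<in> {1..r} \<and> pos_degree E D i v < k" if "v \<in> V - ?G" for v
    using that by (auto simp: not_le)
  then have "\<exists>idx. \<forall>v\<in>V - ?G. idx v \<in> {1..r} \<and> pos_degree E D (idx v) v < k"
    by (intro bchoice) blast
  then obtain idx where idx: "\<And>v. v \<in> V - ?G \<Longrightarrow> idx v \<in> {1..r} \<and> pos_degree E D (idx v) v < k"
    by blast
  \<comment> \<open>Fixing one deficient position \<open>idx v\<close> for each bad vertex makes the
    sets disjoint.\<close>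
  define A where "A i = {v \<in> V - ?G. idx v = i}" for i
  have "sparse (k - 1) E (A i)" if i: "i \<in> {1..r}" for i
    unfolding sparse_def
  proof (intro allI impI)
    fix F assume F: "F \<subseteq> A i"
    then have "F \<subseteq> V" unfolding A_def by blast
    then have finF: "finite F" using finV finite_subset by blast
    \<comment> \<open>An edge inside \<open>F\<close> has its vertex in position \<open>i\<close> in
      \<open>F\<close>, so the position degrees on \<open>F\<close> count it.\<close>
    have "induced_edges E F \<subseteq> (\<Union>v\<in>F. {e \<in> E. D e i = v})"
      using D(1) i unfolding orientation_def induced_edges_def bij_betw_def by fastforce
    then have "card (induced_edges E F) \<le> card (\<Union>v\<in>F. {e \<in> E. D e i = v})"
      using finE finF by (intro card_mono) auto
    also have "\<dots> \<le> (\<Sum>v\<in>F. pos_degree E D i v)"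
      unfolding pos_degree_def by (rule card_UN_le[OF finF])
    also have "\<dots> \<le> (\<Sum>v\<in>F. k - 1)"
    proof (rule sum_mono)
      fix v assume "v \<in> F"
      then have "v \<in> V - ?G" "idx v = i" using F unfolding A_def by auto
      then show "pos_degree E D i v \<le> k - 1" using idx[of v] by auto
    qed
    finally show "card (induced_edges E F) \<le> (k - 1) * card F" by (simp add: mult.commute)
  qed
  moreover have "disjoint_family_on A {1..r}" unfolding A_def disjoint_family_on_def by auto
  moreover have "A i \<subseteq> V" for i unfolding A_def by auto
  ultimately have "card (\<Union>i\<in>{1..r}. A i) \<le> M_num r V E (k - 1)"
    using M_num_ge[OF H r] by blast
  moreover have "(\<Union>i\<in>{1..r}. A i) = V - ?G" using idx unfolding A_def by blast
  moreover have "card (V - ?G) = card V - card ?G" using finV by (intro card_Diff_subset) auto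
  moreover have "card ?G \<le> card V" using finV by (intro card_mono) auto
  ultimately show "card V \<le> f_one r V E k + M_num r V E (k - 1)" using D(2) by simp
qed

section \<open>Independent and degenerate sets\<close>

lemma independence_number_ge:
  assumes "finite V" and "independent_set r V E S"
  shows "card S \<le> independence_number r V E"
  unfolding independence_number_def
proof (rule Max_ge)
  show "finite {card S | S. independent_set r V E S}"
    using assms(1)
    by (rule finite_cards) (auto simp: independent_set_def)
qed (use assms(2) in blast)

lemma finite_beta_num_set:
  assumes "finite V"
  shows "finite {card F | F. F \<subseteq> V \<and> degenerate d F (induced_edges E F)}"
  using assms by (rule finite_cards) auto

lemma beta_num_ge:
  assumes "finite V" and "F \<subseteq> V" and "degenerate d F E"
  shows "card F \<le> beta_num d V E"
  unfolding beta_num_def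
proof (rule Max_ge[OF finite_beta_num_set[OF assms(1)]])
qed (use assms(2,3) degenerate_induced_edges in blast)

lemma beta_num_attained:
  assumes "finite V"
  obtains F where "F \<subseteq> V" "degenerate d F E" "beta_num d V E = card F"
proof -
  let ?Z = "{card F | F. F \<subseteq> V \<and> degenerate d F (induced_edges E F)}"
  have "degenerate d {} (induced_edges E {})" by (auto simp: degenerate_def)
  then have "?Z \<noteq> {}" by blast
  from Max_in[OF finite_beta_num_set[OF assms] this] show ?thesis
    using that degenerate_induced_edges unfolding beta_num_def by blast
qed

lemma M_num_le_mult:
  assumes H: "uniform_hypergraph r V E" and r: "r > 0"
    and b: "\<And>A. A \<subseteq> V \<Longrightarrow> sparse j E A \<Longrightarrow> card A \<le> b"
  shows "M_num r V E j \<le> r * b"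
proof -
  obtain A where A: "disjoint_family_on A {1..r}"
    "\<And>i. i \<in> {1..r} \<Longrightarrow> A i \<subseteq> V \<and> sparse j E (A i)"
    "M_num r V E j = card (\<Union>i\<in>{1..r}. A i)"
    using M_num_attained[OF H r] by metis
  have "card (\<Union>i\<in>{1..r}. A i) \<le> (\<Sum>i\<in>{1..r}. card (A i))" by (rule card_UN_le) simp
  also have "\<dots> \<le> (\<Sum>i\<in>{1..r}. b)" using A(2) b by (intro sum_mono) blast
  finally show ?thesis using A(3) by simp
qed

lemma M_num_le_beta_num:
  assumes H: "uniform_hypergraph r V E" and r: "r > 0"
  shows "M_num r V E j \<le> r * beta_num (r * j) V E"
proof (rule M_num_le_mult[OF H r])
  fix A assume "A \<subseteq> V" "sparse j E A"
  then show "card A \<le> beta_num (r * j) V E"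
    using H sparse_imp_degenerate[OF H] by (intro beta_num_ge) (auto simp: uniform_hypergraph_def)
qed

text \<open>Greedy colouring with \<open>d + 1\<close> colours and \<open>k = 1\<close>: the classes
  are \<open>0\<close>-sparse, so they contain no edge and are independent.\<close>

lemma degenerate_card_le:
  assumes H: "uniform_hypergraph r V E" and r: "r \<ge> 2" and A: "A \<subseteq> V"
    and deg: "degenerate d A E"
  shows "card A \<le> (d + 1) * independence_number r V E"
proof -
  have finV: "finite V" using H by (simp add: uniform_hypergraph_def)
  obtain c where c: "\<And>v. v \<in> A \<Longrightarrow> c v < d + 1"
      "\<And>i. i < d + 1 \<Longrightarrow> sparse 0 E {v \<in> A. c v = i}"
    using degenerate_sparse_colouring[OF H r A deg, of "d + 1" 1] by auto
  have indep: "independent_set r V E {v \<in> A. c v = i}" if "i < d + 1" for i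
    unfolding independent_set_def
  proof (intro conjI ballI)
    let ?S = "{v \<in> A. c v = i}"
    show "?S \<subseteq> V" using A by auto
    fix e assume e: "e \<in> E"
    then have ce: "finite e" "card e = r"
      using H finite_subset unfolding uniform_hypergraph_def by blast+
    have "induced_edges E ?S = {}"
      using c(2)[OF that] uniform_hypergraph_finite_edges[OF H]
      by (auto simp: sparse_def induced_edges_def card_eq_0_iff)
    then have "?S \<inter> e \<noteq> e" using e by (auto simp: induced_edges_def)
    then have "?S \<inter> e \<subset> e" by blast
    then have "card (?S \<inter> e) < r" using psubset_card_mono[OF ce(1)] ce(2) by blast
    then show "card (?S \<inter> e) \<le> r - 1" by simp
  qed
  have "A = (\<Union>i<d + 1. {v \<in> A. c v = i})" using c(1) by auto
  then have "card A \<le> (\<Sum>i<d + 1. card {v \<in> A. c v = i})"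
    using card_UN_le[of "{..<d + 1}" "\<lambda>i. {v \<in> A. c v = i}"] by simp
  also have "\<dots> \<le> (\<Sum>i<d + 1. independence_number r V E)"
    using indep by (intro sum_mono independence_number_ge[OF finV]) auto
  finally show ?thesis by simp
qed

lemma M_num_le_independence_number:
  assumes H: "uniform_hypergraph r V E" and r: "r \<ge> 2"
  shows "M_num r V E j \<le> r * ((r * j + 1) * independence_number r V E)"
proof (rule M_num_le_mult[OF H])
  fix A assume "A \<subseteq> V" "sparse j E A"
  then show "card A \<le> (r * j + 1) * independence_number r V E"
    using sparse_imp_degenerate[OF H] by (intro degenerate_card_le[OF H r]) auto
qed (use r in simp)

text \<open>As \<open>r * k - 1 < r * k\<close>, the greedy colouring splits an optimal degenerate
  set into \<open>r\<close> sparse classes.\<close>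

lemma beta_num_le_M_num:
  assumes H: "uniform_hypergraph r V E" and r: "r \<ge> 2" and k: "k \<ge> 1"
  shows "beta_num (r * k - 1) V E \<le> M_num r V E (k - 1)"
proof -
  have finV: "finite V" using H by (simp add: uniform_hypergraph_def)
  obtain F where F: "F \<subseteq> V" "degenerate (r * k - 1) F E" "beta_num (r * k - 1) V E = card F"
    using beta_num_attained[OF finV] by metis
  obtain c where c: "\<And>v. v \<in> F \<Longrightarrow> c v < r"
      "\<And>i. i < r \<Longrightarrow> sparse (k - 1) E {v \<in> F. c v = i}"
    using degenerate_sparse_colouring[OF H r F(1,2), of r k] r k by auto
  \<comment> \<open>Colours start at 0, positions at 1.\<close>
  let ?A = "\<lambda>i. {v \<in> F. Suc (c v) = i}"
  have "sparse (k - 1) E (?A i)" if "i \<in> {1..r}" for i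
  proof -
    have "?A i = {v \<in> F. c v = i - 1}" using that by auto
    then show ?thesis using c(2)[of "i - 1"] that by auto
  qed
  then have "card (\<Union>i\<in>{1..r}. ?A i) \<le> M_num r V E (k - 1)"
    using r F(1) by (intro M_num_ge[OF H]) (auto simp: disjoint_family_on_def)
  moreover have "(\<Union>i\<in>{1..r}. ?A i) = F" using c(1) by (auto simp: Suc_le_eq)
  ultimately show ?thesis using F(3) by simp
qed

section \<open>Degenerate sets in graphs\<close>

text \<open>In a graph the only possible edge through two distinct vertices is the pair
  itself.\<close>

lemma degree_induced_edges_remove:
  assumes G: "simple_graph W B" and uv: "u \<in> F" "v \<in> F" "v \<noteq> u"
  shows "degree (induced_edges B F) v =
    degree (induced_edges B (F - {u})) v + (if {u, v} \<in> B then 1 else 0)"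
proof -
  have finB: "finite B" using uniform_hypergraph_finite_edges[OF G] .
  have pair: "e = {u, v}" if "e \<in> B" "u \<in> e" "v \<in> e" for e
  proof -
    have "card e = 2" using G that unfolding uniform_hypergraph_def by blast
    then show ?thesis using that uv(3) by (auto simp: card_2_iff)
  qed
  let ?X = "{e \<in> induced_edges B (F - {u}). v \<in> e}"
  have "{e \<in> induced_edges B F. v \<in> e} = ?X \<union> {e. e = {u, v} \<and> e \<in> B}"
    using uv pair unfolding induced_edges_def by auto
  moreover have "?X \<inter> {e. e = {u, v} \<and> e \<in> B} = {}" unfolding induced_edges_def by auto
  moreover have "finite ?X" using finB by (auto simp: induced_edges_def)
  moreover have "card {e. e = {u, v} \<and> e \<in> B} = (if {u, v} \<in> B then 1 else 0)"
  proof -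
    have "{e. e = {u, v} \<and> e \<in> B} = (if {u, v} \<in> B then {{u, v}} else {})" by auto
    then show ?thesis by simp
  qed
  ultimately show ?thesis
    unfolding degree_def by (simp add: card_Un_disjoint)
qed

lemma degree_induced_edges_eq_card_neighbours:
  assumes G: "simple_graph W B" and u: "u \<in> F"
  shows "degree (induced_edges B F) u = card {v \<in> F - {u}. {u, v} \<in> B}"
proof -
  have "bij_betw (\<lambda>v. {u, v}) {v \<in> F - {u}. {u, v} \<in> B} {e \<in> induced_edges B F. u \<in> e}"
    unfolding bij_betw_def
  proof (intro conjI set_eqI iffI)
    show "inj_on (\<lambda>v. {u, v}) {v \<in> F - {u}. {u, v} \<in> B}"
      by (auto simp: inj_on_def doubleton_eq_iff)
    fix e assume e: "e \<in> {e \<in> induced_edges B F. u \<in> e}"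
    then have "card e = 2" using G unfolding uniform_hypergraph_def induced_edges_def by blast
    then obtain v where "e = {u, v}" "v \<noteq> u" using e by (auto simp: card_2_iff)
    then show "e \<in> (\<lambda>v. {u, v}) ` {v \<in> F - {u}. {u, v} \<in> B}"
      using e unfolding induced_edges_def by auto
  qed (use u in \<open>auto simp: induced_edges_def\<close>)
  then show ?thesis unfolding degree_def by (simp add: bij_betw_same_card)
qed

text \<open>The degree of \<open>v\<close> can only decrease when \<open>F\<close> shrinks, so
  \<open>v\<close> itself is the witness in every subset containing it.\<close>

lemma degenerate_insert:
  assumes "finite E" and "degenerate d S E" and "S \<subseteq> F" and "v \<in> F"
    and "degree (induced_edges E F) v \<le> d"
  shows "degenerate d (insert v S) E"
  unfolding degenerate_def
proof (intro allI impI)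
  fix T assume T: "T \<noteq> {} \<and> T \<subseteq> insert v S"
  show "\<exists>u\<in>T. degree (induced_edges E T) u \<le> d"
  proof (cases "v \<in> T")
    case True
    have "degree (induced_edges E T) v \<le> degree (induced_edges E F) v"
      unfolding degree_def using assms T
      by (intro card_mono) (auto simp: induced_edges_def)
    then show ?thesis using True assms(5) by (intro bexI[of _ v]) auto
  next
    case False
    then have "T \<subseteq> S" using T by blast
    then show ?thesis using assms(2) T unfolding degenerate_def by blast
  qed
qed

theorem alon_kahn_seymour:
  assumes G: "simple_graph W B" and F: "F \<subseteq> W" and m: "m \<ge> 1"
  shows "\<exists>S\<subseteq>F. degenerate (m - 1) S B \<and>
    (\<Sum>v\<in>F. min 1 (real m / (real (degree (induced_edges B F) v) + 1))) \<le> real (card S)"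
proof -
  have finB: "finite B" using uniform_hypergraph_finite_edges[OF G] .
  define g where "g x = min 1 (real m / (real x + 1))" for x :: nat
  have anti: "g y \<le> g x" if "x \<le> y" for x y
  proof -
    have "real m / (real y + 1) \<le> real m / (real x + 1)"
      using that by (intro divide_left_mono) auto
    then show ?thesis unfolding g_def by linarith
  qed
  have "finite F" using F G finite_subset unfolding uniform_hypergraph_def by blast
  then have "\<exists>S\<subseteq>F. degenerate (m - 1) S B \<and>
      (\<Sum>v\<in>F. g (degree (induced_edges B F) v)) \<le> real (card S)"
    using F
  proof (induction F rule: finite_psubset_induct)
    case (psubset F)
    let ?d = "degree (induced_edges B F)"
    have IH: "\<exists>S\<subseteq>F - {u}. degenerate (m - 1) S B \<and>
        (\<Sum>v\<in>F - {u}. g (degree (induced_edges B (F - {u})) v)) \<le> real (card S)"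
      if "u \<in> F" for u
      using that psubset.prems by (intro psubset.IH) auto
    consider "F = {}" | u where "u \<in> F" "?d u < m" | "F \<noteq> {}" "\<forall>u\<in>F. m \<le> ?d u"
      by (metis not_le)
    then show ?case
    proof cases
      case 1
      then show ?thesis by (auto simp: degenerate_def)
    next
      \<comment> \<open>Keeping \<open>u\<close> gains 1, which covers its summand; the other
        summands do not decrease when degrees drop.\<close>
      case 2
      obtain S where S: "S \<subseteq> F - {u}" "degenerate (m - 1) S B"
          "(\<Sum>v\<in>F - {u}. g (degree (induced_edges B (F - {u})) v)) \<le> real (card S)"
        using IH[OF 2(1)] by blast
      have "(\<Sum>v\<in>F. g (?d v)) = g (?d u) + (\<Sum>v\<in>F - {u}. g (?d v))"
        using 2(1) psubset.hyps by (simp add: sum.remove)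
      also have "\<dots> \<le> 1 + (\<Sum>v\<in>F - {u}. g (degree (induced_edges B (F - {u})) v))"
        using degree_induced_edges_remove[OF G 2(1)]
        by (intro add_mono sum_mono anti) (auto simp: g_def)
      also have "\<dots> \<le> real (card (insert u S))"
        using S finite_subset[OF S(1)] psubset.hyps by (subst card_insert_disjoint) auto
      finally have "(\<Sum>v\<in>F. g (?d v)) \<le> real (card (insert u S))" .
      moreover have "degenerate (m - 1) (insert u S) B"
        using S 2 by (intro degenerate_insert[OF finB, of _ _ F]) auto
      ultimately show ?thesis using S(1) 2(1) by (intro exI[of _ "insert u S"]) auto
    next
      case 3
      define D where "D = Max (?d ` F)"
      have "D \<in> ?d ` F" unfolding D_def using 3 psubset.hyps by (intro Max_in) auto
      then obtain u where u: "u \<in> F" "?d u = D" by auto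
      have le: "?d v \<le> D" if "v \<in> F" for v unfolding D_def using that psubset.hyps by auto
      have mD: "m \<le> D" using 3 u by auto
      obtain S where S: "S \<subseteq> F - {u}" "degenerate (m - 1) S B"
          "(\<Sum>v\<in>F - {u}. g (degree (induced_edges B (F - {u})) v)) \<le> real (card S)"
        using IH[OF u(1)] by blast
      let ?N = "{v \<in> F - {u}. {u, v} \<in> B}"
      \<comment> \<open>This is \<open>m / D - m / (D + 1)\<close>, the least gain of a neighbour of
        \<open>u\<close> whose degree, at most \<open>D\<close>, drops by one. All degrees are at
        least \<open>m\<close>, so the cap 1 in \<open>g\<close> does not cut the gain.\<close>
      define q where "q = real m / (real D * (real D + 1))"
      have step: "g (?d v) + (if v \<in> ?N then q else 0) \<le> g (degree (induced_edges B (F - {u})) v)"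
        if v: "v \<in> F - {u}" for v
      proof (cases "v \<in> ?N")
        case True
        let ?y = "degree (induced_edges B (F - {u})) v"
        have dv: "?d v = ?y + 1" using degree_induced_edges_remove[OF G u(1)] v True by auto
        have "v \<in> F" using v by simp
        then have "m \<le> ?d v" "?d v \<le> D" using 3(2) le by blast+
        then have y: "real m \<le> real ?y + 1" "real ?y + 1 \<le> real D" unfolding dv by linarith+
        have "g ?y = real m / (real ?y + 1)" using y m unfolding g_def by (simp add: min_def divide_le_eq)
        moreover have "g (?d v) \<le> real m / (real ?y + 2)" unfolding g_def dv by (simp add: add.commute)
        moreover have "q \<le> real m / ((real ?y + 1) * (real ?y + 2))"
          unfolding q_def using y by (intro divide_left_mono mult_mono) auto
        moreover have "real m / (real ?y + 2) + real m / ((real ?y + 1) * (real ?y + 2)) = real m / (real ?y + 1)"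
          by (simp add: divide_simps) (simp add: algebra_simps)
        ultimately show ?thesis using True by simp
      next
        case False
        then show ?thesis using degree_induced_edges_remove[OF G u(1)] v by auto
      qed
      have "(\<Sum>v\<in>F. g (?d v)) = (\<Sum>v\<in>F - {u}. g (?d v)) + g D"
        using u psubset.hyps by (simp add: sum.remove)
      also have "g D \<le> real m / (real D + 1)" unfolding g_def by simp
      \<comment> \<open>The gains of the \<open>D\<close> neighbours pay for the lost summand of
        \<open>u\<close>.\<close>
      also have "real m / (real D + 1) = real D * q"
        unfolding q_def using m mD by simp
      also have "real D * q = (\<Sum>v\<in>F - {u}. if v \<in> ?N then q else 0)"
      proof -
        have "card ?N = D" using degree_induced_edges_eq_card_neighbours[OF G u(1)] u(2) by simp
        moreover have "(\<Sum>v\<in>F - {u}. if v \<in> ?N then q else 0) = (\<Sum>v\<in>?N. q)"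
          using psubset.hyps by (intro sum.mono_neutral_cong_right) auto
        ultimately show ?thesis by simp
      qed
      also have "(\<Sum>v\<in>F - {u}. g (?d v)) + (\<Sum>v\<in>F - {u}. if v \<in> ?N then q else 0) \<le>
          (\<Sum>v\<in>F - {u}. g (degree (induced_edges B (F - {u})) v))"
        unfolding sum.distrib[symmetric] using step by (rule sum_mono)
      also have "\<dots> \<le> real (card S)" by (rule S(3))
      finally show ?thesis using S(1,2) by (intro exI[of _ S]) auto
    qed
  qed
  then show ?thesis unfolding g_def .
qed

text \<open>The line is the chord of \<open>t / (x + 1)\<close> between \<open>x = m\<close> and \<open>x = m + 1\<close>; it bounds the function
  from below at integers, and from above between the two points. The hypothesis on \<open>m\<close> says that the
  chord is at most \<open>1\<close> at \<open>x = 0\<close>.\<close>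

lemma chord_le_min:
  fixes t m x :: nat
  assumes "2 * t \<le> m + 2"
  shows "real t * (2 * real m + 2 - real x) / ((real m + 1) * (real m + 2))
    \<le> min 1 (real t / (real x + 1))"
proof -
  have "real t * (2 * real m + 2 - real x) \<le> real t * (2 * real m + 2)"
    by (intro mult_left_mono) auto
  also have "\<dots> = (2 * real t) * (real m + 1)" by (simp add: algebra_simps)
  also have "\<dots> \<le> (real m + 2) * (real m + 1)"
    using assms by (intro mult_right_mono) linarith+
  finally have 1: "real t * (2 * real m + 2 - real x) / ((real m + 1) * (real m + 2)) \<le> 1"
    by (simp add: divide_le_eq mult.commute)
  \<comment> \<open>Integrality of \<open>x\<close> enters here: no integer lies strictly between
    \<open>m\<close> and \<open>m + 1\<close>.\<close>
  have "0 \<le> (real x - real m) * (real x - real m - 1)"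
  proof (cases "x \<le> m")
    case True
    then show ?thesis by (intro mult_nonpos_nonpos) linarith+
  next
    case False
    then show ?thesis by (intro mult_nonneg_nonneg) linarith+
  qed
  then have "(2 * real m + 2 - real x) * (real x + 1) \<le> (real m + 1) * (real m + 2)"
    by (simp add: algebra_simps)
  then have "real t * ((2 * real m + 2 - real x) * (real x + 1)) \<le> real t * ((real m + 1) * (real m + 2))"
    by (intro mult_left_mono) auto
  then have "real t * (2 * real m + 2 - real x) / ((real m + 1) * (real m + 2)) \<le> real t / (real x + 1)"
    by (simp add: divide_le_eq le_divide_eq mult.assoc)
  with 1 show ?thesis by simp
qed

lemma le_chord:
  fixes t m :: nat and a :: real
  assumes "real m \<le> a" and "a \<le> real m + 1"
  shows "real t / (a + 1) \<le> real t * (2 * real m + 2 - a) / ((real m + 1) * (real m + 2))"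
proof -
  \<comment> \<open>The same quadratic with the opposite sign, now between its roots.\<close>
  have "0 \<le> (a - real m) * (real m + 1 - a)" using assms by (intro mult_nonneg_nonneg) auto
  then have "(real m + 1) * (real m + 2) \<le> (2 * real m + 2 - a) * (a + 1)"
    by (simp add: algebra_simps)
  then have "real t * ((real m + 1) * (real m + 2)) \<le> real t * ((2 * real m + 2 - a) * (a + 1))"
    by (intro mult_left_mono) auto
  moreover have "a + 1 > 0" using assms by linarith
  ultimately show ?thesis by (simp add: divide_le_eq le_divide_eq mult.assoc)
qed

text \<open>The chord is affine, so its sum over the degrees is \<open>card W\<close> times its
  value at the average degree. This replaces Jensen's inequality for the capped function.\<close>

lemma beta_num_average_degree:
  assumes G: "simple_graph W B" and W: "W \<noteq> {}" and t: "t \<ge> 1"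
    and avg: "average_degree W B \<ge> 2 * real t - 2"
  shows "real t / (average_degree W B + 1) * real (card W) \<le> real (beta_num (t - 1) W B)"
proof -
  let ?a = "average_degree W B" and ?n = "real (card W)"
  have finW: "finite W" using G by (simp add: uniform_hypergraph_def)
  have n: "?n > 0" using finW W by (simp add: card_gt_0_iff)
  define m where "m = nat \<lfloor>?a\<rfloor>"
  have "?a \<ge> 0" using avg t by linarith
  then have m: "real m \<le> ?a" "?a \<le> real m + 1" unfolding m_def by linarith+
  \<comment> \<open>Strictness of the floor bound lets integrality sharpen this to the hypothesis of
    \<open>chord_le_min\<close>.\<close>
  have "2 * real t - 2 < real m + 1" using avg m t unfolding m_def by linarith
  then have tm: "2 * t \<le> m + 2" by linarith
  have W_ind: "induced_edges B W = B"
    using G unfolding uniform_hypergraph_def induced_edges_def by auto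
  let ?L = "\<lambda>x. real t * (2 * real m + 2 - x) / ((real m + 1) * (real m + 2))"
  have "real t / (?a + 1) * ?n \<le> ?L ?a * ?n"
    using le_chord[OF m] by (rule mult_right_mono) simp
  also have "\<dots> = (\<Sum>v\<in>W. ?L (real (degree B v)))"
  proof -
    have "(\<Sum>v\<in>W. ?L (real (degree B v))) =
        real t * (\<Sum>v\<in>W. 2 * real m + 2 - real (degree B v)) / ((real m + 1) * (real m + 2))"
      by (simp only: sum_divide_distrib sum_distrib_left)
    also have "(\<Sum>v\<in>W. 2 * real m + 2 - real (degree B v)) = (2 * real m + 2 - ?a) * ?n"
    proof -
      have "(\<Sum>v\<in>W. real (degree B v)) = ?a * ?n" using n by (simp add: average_degree_def)
      then show ?thesis by (simp add: sum_subtractf algebra_simps)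
    qed
    finally show ?thesis by simp
  qed
  also have "\<dots> \<le> (\<Sum>v\<in>W. min 1 (real t / (real (degree B v) + 1)))"
    using chord_le_min[OF tm] by (rule sum_mono)
  also have "\<dots> \<le> real (beta_num (t - 1) W B)"
  proof -
    obtain S where S: "S \<subseteq> W" "degenerate (t - 1) S B"
        "(\<Sum>v\<in>W. min 1 (real t / (real (degree B v) + 1))) \<le> real (card S)"
      using alon_kahn_seymour[OF G order.refl t] unfolding W_ind by blast
    then show ?thesis using beta_num_ge[OF finW S(1,2)] by linarith
  qed
  finally show ?thesis .
qed

theorem theorem5:
  fixes r n k :: nat
    and V :: "'a set" and E :: "'a set set"
    and W :: "'b set" and B :: "'b set set"
  assumes "r \<ge> 2" and "k \<ge> 1"
    and H: "uniform_hypergraph r V E" and "card V = n"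
    and G: "simple_graph W B" and "card W = n"
  shows "(int (f_one r V E k) = int n - int (M_num r V E (k - 1))
          \<and> int n - int (M_num r V E (k - 1))
              \<ge> int n - int (independence_number r V E) * int r * (int r * int k - int r + 1))
       \<and> (int n - int (beta_num (r * k - 1) V E) \<ge> int (f_one r V E k)
          \<and> int (f_one r V E k) \<ge> int n - int r * int (beta_num (r * (k - 1)) V E))
       \<and> (average_degree W B \<ge> 4 * real k - 2 \<longrightarrow>
            real (f_graph W B k)
              \<le> (average_degree W B - 2 * real k + 1) / (average_degree W B + 1) * real n)"
proof -
  have r: "r > 0" using \<open>r \<ge> 2\<close> by simp
  have fM: "int (f_one r V E k) = int n - int (M_num r V E (k - 1))"
    using f_one_plus_M_num[OF H r \<open>k \<ge> 1\<close>] \<open>card V = n\<close> by linarith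
  have "int (M_num r V E (k - 1)) \<le> int (r * ((r * (k - 1) + 1) * independence_number r V E))"
    using M_num_le_independence_number[OF H \<open>r \<ge> 2\<close>] by (simp only: of_nat_le_iff)
  also have "\<dots> = int (independence_number r V E) * int r * (int r * int k - int r + 1)"
  proof -
    \<comment> \<open>This removes the truncated subtraction in \<open>k - 1\<close>.\<close>
    obtain l where "k = Suc l" using \<open>k \<ge> 1\<close> by (cases k) auto
    then show ?thesis by (simp add: algebra_simps)
  qed
  finally have 1: "int n - int (M_num r V E (k - 1))
      \<ge> int n - int (independence_number r V E) * int r * (int r * int k - int r + 1)" by simp
  have 2: "int n - int (beta_num (r * k - 1) V E) \<ge> int (f_one r V E k)"
    using fM beta_num_le_M_num[OF H \<open>r \<ge> 2\<close> \<open>k \<ge> 1\<close>] by simp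
  have "int (M_num r V E (k - 1)) \<le> int (r * beta_num (r * (k - 1)) V E)"
    using M_num_le_beta_num[OF H r] by (simp only: of_nat_le_iff)
  then have 3: "int (f_one r V E k) \<ge> int n - int r * int (beta_num (r * (k - 1)) V E)"
    using fM by simp
  have 4: "real (f_graph W B k)
      \<le> (average_degree W B - 2 * real k + 1) / (average_degree W B + 1) * real n"
    if avg: "average_degree W B \<ge> 4 * real k - 2"
  proof -
    let ?a = "average_degree W B"
    have pos: "?a > 0" using avg \<open>k \<ge> 1\<close> by linarith
    \<comment> \<open>Division by zero gives the empty graph average degree 0.\<close>
    then have "W \<noteq> {}" by (auto simp: average_degree_def)
    \<comment> \<open>Taking \<open>t = 2 * k\<close> turns the bound \<open>2 * t - 2\<close> into
      \<open>4 * k - 2\<close>, and \<open>t - 1\<close> into the degeneracy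
      \<open>r * k - 1\<close> for \<open>r = 2\<close>.\<close>
    then have "real (2 * k) / (?a + 1) * real n \<le> real (beta_num (2 * k - 1) W B)"
      using avg \<open>k \<ge> 1\<close> beta_num_average_degree[OF G, of "2 * k"] \<open>card W = n\<close> by simp
    moreover have "f_graph W B k + beta_num (2 * k - 1) W B \<le> n"
      using f_one_plus_M_num[OF G _ \<open>k \<ge> 1\<close>] beta_num_le_M_num[OF G _ \<open>k \<ge> 1\<close>] \<open>card W = n\<close>
      unfolding f_graph_def by simp
    then have "real (f_graph W B k) + real (beta_num (2 * k - 1) W B) \<le> real n" by linarith
    ultimately have "real (f_graph W B k) \<le> real n - real (2 * k) / (?a + 1) * real n"
      by linarith
    also have "\<dots> = (?a - 2 * real k + 1) / (?a + 1) * real n"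
      using pos by (simp add: field_simps)
    finally show ?thesis .
  qed
  show ?thesis using fM 1 2 3 4 by blast
qed

end
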